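(* Let $V$ be a finite set with $|V|\ge 2$ and let $A$ be a real symmetric matrix indexed by $V$. If $A$ has no self-contained pair of weighted chordless walks, then at least one of the following holds: (A) $A$ has a critical walk; (B) $A$ has two distinct simplicial vertices $u,v$ with $A_{uv}=\min A$.
   Context: $\min A=\min\{A_{xy}: x\ne y\in V\}$. An element $v\in V$ is simplicial in $A$ if $A_{yz}\ge\min\{A_{vy},A_{vz}\}$ for all distinct $y,z\in V\setminus\{v\}$. A walk is an ordered sequence $W=(v_0,\dots,v_p)$ ($p\ge1$) of elements of $V$; $V(W)=\{v_0,\dots,v_p\}$, $I(W)=\{v_1,\dots,v_{p-1}\}$ (internal elements); $W$ is closed if $v_0=v_p$. $W$ is weighted chordless in $A$ if $A_{v_{i-1}v_{i+1}}<\min\{A_{v_{i-1}v_i},A_{v_{i+1}v_i}\}$ for all $1\le i\le p-1$. A pair of walks $W_1,W_2$ is self-contained if $V(W_1)\cup V(W_2)=I(W_1)\cup I(W_2)$. A critical walk of $A$ is a closed weighted chordless walk $W=(v_0,\dots,v_p)$ whose end point $v_0$ is simplicial in $A$ and such that there is an internal element $u\in I(W)$ with $A_{v_0u}=\min A$. *)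

theory Defs
  imports Complex_Main
begin

text \<open>A real symmetric matrix indexed by a finite set V is modelled as a function
  A :: 'a => 'a => real together with symmetry on V. Walks are lists of elements
  of V of length at least 2 (i.e. W = (v_0,...,v_p), p >= 1).\<close>

definition minA :: "'a set \<Rightarrow> ('a \<Rightarrow> 'a \<Rightarrow> real) \<Rightarrow> real" where
  "minA V A = Min {A x y | x y. x \<in> V \<and> y \<in> V \<and> x \<noteq> y}"

definition simplicial :: "'a set \<Rightarrow> ('a \<Rightarrow> 'a \<Rightarrow> real) \<Rightarrow> 'a \<Rightarrow> bool" where
  "simplicial V A v \<longleftrightarrow> v \<in> V \<and>
     (\<forall>y \<in> V - {v}. \<forall>z \<in> V - {v}. y \<noteq> z \<longrightarrow> A y z \<ge> min (A v y) (A v z))"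

definition is_walk :: "'a set \<Rightarrow> 'a list \<Rightarrow> bool" where
  "is_walk V W \<longleftrightarrow> length W \<ge> 2 \<and> set W \<subseteq> V"

definition internal :: "'a list \<Rightarrow> 'a set" where
  "internal W = {W ! i | i. 1 \<le> i \<and> i + 1 < length W}"

definition closed_walk :: "'a list \<Rightarrow> bool" where
  "closed_walk W \<longleftrightarrow> hd W = last W"

definition weighted_chordless :: "('a \<Rightarrow> 'a \<Rightarrow> real) \<Rightarrow> 'a list \<Rightarrow> bool" where
  "weighted_chordless A W \<longleftrightarrow>
     (\<forall>i. 1 \<le> i \<and> i + 1 < length W \<longrightarrow>
        A (W ! (i - 1)) (W ! (i + 1)) < min (A (W ! (i - 1)) (W ! i)) (A (W ! (i + 1)) (W ! i)))"

definition self_contained :: "'a list \<Rightarrow> 'a list \<Rightarrow> bool" where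
  "self_contained W1 W2 \<longleftrightarrow> set W1 \<union> set W2 = internal W1 \<union> internal W2"

definition critical_walk :: "'a set \<Rightarrow> ('a \<Rightarrow> 'a \<Rightarrow> real) \<Rightarrow> 'a list \<Rightarrow> bool" where
  "critical_walk V A W \<longleftrightarrow> is_walk V W \<and> closed_walk W \<and> weighted_chordless A W \<and>
     simplicial V A (hd W) \<and> (\<exists>u \<in> internal W. A (hd W) u = minA V A)"

end

theory Submission
  imports Defs
begin

text \<open>
  Suppose that there is no self-contained pair. The key statement (\<open>simplicial_or_walk\<close>) is
  relative to a proper subset \<open>S\<close> of the ground set: if no vertex outside
  \<open>S\<close> is simplicial, then some chordless walk has its ends in \<open>S\<close> and its interior outside \<open>S\<close>.
  By induction on the size of the ground set, let \<open>m\<close> be the minimal entry, attained at \<open>(a, b)\<close>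
  with \<open>a \<notin> S\<close> (if it is attained only inside \<open>S\<close>, a three-term walk does), and separate \<open>a\<close> from \<open>b\<close> in the graph of the entries exceeding \<open>m\<close> by a set \<open>N\<close>
  with full components \<open>C \<ni> a\<close> and \<open>D \<ni> b\<close>. The induction hypothesis for \<open>C \<union> N\<close> gives a walk through
  \<open>C\<close> with ends in \<open>N \<union> S\<close>, and an end in \<open>N\<close> can be prolonged to any vertex of \<open>D\<close> along a
  shortest path, because entries between \<open>C\<close> and \<open>D\<close> are minimal. If \<open>S\<close> meets \<open>C\<close> or \<open>D\<close>, the walk on
  the other side is prolonged into \<open>S\<close>; otherwise the walks through \<open>C\<close> and \<open>D\<close>, each prolonged at
  both ends to an internal vertex of the other, form a self-contained pair.

  With \<open>S = {}\<close> this yields a simplicial \<open>w\<close>, which must attain the minimum; with \<open>S\<close> consisting of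
  \<open>w\<close> and the \<open>x\<close> with \<open>A w x > m\<close> it yields a second simplicial vertex or a walk that closes up to
  a critical walk at \<open>w\<close>.
\<close>

section \<open>Interiors of walks and minimal entries\<close>

lemma internal_Cons_snoc: "internal (x # xs @ [y]) = set xs"
proof -
  have "internal (x # xs @ [y]) = {xs ! j | j. j < length xs}"
    unfolding internal_def
  proof (intro equalityI subsetI)
    fix u assume "u \<in> {(x # xs @ [y]) ! i | i. 1 \<le> i \<and> i + 1 < length (x # xs @ [y])}"
    then obtain i where i: "u = (x # xs @ [y]) ! i" "1 \<le> i" "i + 1 < length (x # xs @ [y])" by blast
    then have "u = xs ! (i - 1)" "i - 1 < length xs" by (auto simp: nth_append nth_Cons')
    then show "u \<in> {xs ! j | j. j < length xs}" by blast
  next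
    fix u assume "u \<in> {xs ! j | j. j < length xs}"
    then obtain j where "u = xs ! j" "j < length xs" by blast
    then have "u = (x # xs @ [y]) ! Suc j \<and> 1 \<le> Suc j \<and> Suc j + 1 < length (x # xs @ [y])"
      by (auto simp: nth_append)
    then show "u \<in> {(x # xs @ [y]) ! i | i. 1 \<le> i \<and> i + 1 < length (x # xs @ [y])}" by blast
  qed
  then show ?thesis by (simp add: set_conv_nth)
qed

lemma minA_eqI:
  assumes "finite V" "x \<in> V" "y \<in> V" "x \<noteq> y"
    and "\<And>u v. u \<in> V \<Longrightarrow> v \<in> V \<Longrightarrow> u \<noteq> v \<Longrightarrow> A x y \<le> A u v"
  shows "minA V A = A x y"
  unfolding minA_def
proof (rule Min_eqI)
  have "{A x y | x y. x \<in> V \<and> y \<in> V \<and> x \<noteq> y} \<subseteq> (\<lambda>(x, y). A x y) ` (V \<times> V)" by auto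
  then show "finite {A x y | x y. x \<in> V \<and> y \<in> V \<and> x \<noteq> y}"
    using assms(1) by (meson finite_SigmaI finite_imageI finite_subset)
qed (use assms in blast)+

lemma attains_minimum:
  fixes A :: "'a \<Rightarrow> 'a \<Rightarrow> real"
  assumes "finite U" "a \<in> U" "b \<in> U" "a \<noteq> b"
  obtains x y where "x \<in> U" "y \<in> U" "x \<noteq> y"
    and "\<And>u v. u \<in> U \<Longrightarrow> v \<in> U \<Longrightarrow> u \<noteq> v \<Longrightarrow> A x y \<le> A u v"
proof -
  define P where "P = {(u, v). u \<in> U \<and> v \<in> U \<and> u \<noteq> v}"
  have "P \<subseteq> U \<times> U" by (auto simp: P_def)
  then have "finite P" using assms(1) by (meson finite_SigmaI finite_subset)
  moreover have "P \<noteq> {}" using assms by (auto simp: P_def)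
  ultimately obtain p where p: "p \<in> P" "\<And>q. q \<in> P \<Longrightarrow> A (fst p) (snd p) \<le> A (fst q) (snd q)"
    using ex_is_arg_min_if_finite[of P "\<lambda>q. A (fst q) (snd q)"]
    by (metis (mono_tags, lifting) is_arg_min_linorder)
  show ?thesis
  proof (rule that)
    show "fst p \<in> U" "snd p \<in> U" "fst p \<noteq> snd p" using p(1) by (auto simp: P_def)
    fix u v assume "u \<in> U" "v \<in> U" "u \<noteq> v"
    then show "A (fst p) (snd p) \<le> A u v" using p(2)[of "(u, v)"] by (auto simp: P_def)
  qed
qed

section \<open>Recursive chordlessness, gluing and reversal\<close>

text \<open>Requiring \<open>x \<noteq> z\<close> makes the diagonal of the matrix irrelevant.\<close>

definition chordless_triple :: "('a \<Rightarrow> 'a \<Rightarrow> real) \<Rightarrow> 'a \<Rightarrow> 'a \<Rightarrow> 'a \<Rightarrow> bool" where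
  "chordless_triple A x y z \<longleftrightarrow> x \<noteq> z \<and> A x z < A x y \<and> A x z < A z y"

fun chordless :: "('a \<Rightarrow> 'a \<Rightarrow> real) \<Rightarrow> 'a list \<Rightarrow> bool" where
  "chordless A (x # y # z # zs) \<longleftrightarrow> chordless_triple A x y z \<and> chordless A (y # z # zs)"
| "chordless A _ \<longleftrightarrow> True"

lemma chordless_nth:
  "chordless A W \<Longrightarrow> i + 2 < length W \<Longrightarrow> chordless_triple A (W ! i) (W ! (i + 1)) (W ! (i + 2))"
proof (induction A W arbitrary: i rule: chordless.induct)
  case (1 A x y z zs)
  then show ?case by (cases i) auto
qed auto

lemma chordless_imp_weighted_chordless:
  assumes "chordless A W" shows "weighted_chordless A W"
  unfolding weighted_chordless_def
proof (intro allI impI)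
  fix i assume "1 \<le> i \<and> i + 1 < length W"
  then obtain j where "i = Suc j" "j + 2 < length W" by (cases i) auto
  then show "A (W ! (i - 1)) (W ! (i + 1)) < min (A (W ! (i - 1)) (W ! i)) (A (W ! (i + 1)) (W ! i))"
    using chordless_nth[OF assms, of j] by (simp add: chordless_triple_def)
qed

text \<open>Exposes the context of a triple as a decomposition of the list, so that the shortest
  path argument can cut vertices out of it.\<close>

lemma chordlessI:
  "(\<And>xs x y z ys. W = xs @ x # y # z # ys \<Longrightarrow> chordless_triple A x y z) \<Longrightarrow> chordless A W"
proof (induction A W rule: chordless.induct)
  case (1 A x y z zs)
  have "chordless_triple A x y z" using 1(2)[of "[]"] by simp
  moreover have "chordless A (y # z # zs)"
  proof (rule 1(1))
    fix xs x' y' z' ys assume "y # z # zs = xs @ x' # y' # z' # ys"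
    then show "chordless_triple A x' y' z'" using 1(2)[of "x # xs"] by simp
  qed
  ultimately show ?case by simp
qed auto

text \<open>Chordlessness constrains only three consecutive vertices, so an overlap of two suffices:
  every triple of the glued walk lies in one of the pieces.\<close>

lemma chordless_glue:
  "chordless A (xs @ [y, z]) \<Longrightarrow> chordless A (y # z # zs) \<Longrightarrow> chordless A (xs @ y # z # zs)"
proof (induction xs)
  case (Cons a xs)
  then show ?case by (cases xs; cases "tl xs") auto
qed simp

lemma chordless_rev:
  assumes "\<And>x y. x \<in> set W \<Longrightarrow> y \<in> set W \<Longrightarrow> A x y = A y x" "chordless A W"
  shows "chordless A (rev W)"
  using assms
proof (induction A W rule: chordless.induct)
  case (1 A x y z zs)
  have "chordless A (rev (y # z # zs))" using 1 by simp
  moreover have "chordless_triple A z y x"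
    using 1(2)[of x z] 1(3) by (auto simp: chordless_triple_def)
  ultimately show ?case using chordless_glue[of A "rev zs" z y "[x]"] by simp
qed auto

section \<open>The threshold graph and its shortest paths\<close>

definition exceeds :: "('a \<Rightarrow> 'a \<Rightarrow> real) \<Rightarrow> real \<Rightarrow> 'a \<Rightarrow> 'a \<Rightarrow> bool" where
  "exceeds A m x y \<longleftrightarrow> x \<noteq> y \<and> m < A x y"

text \<open>The closure is reflexive on the whole type; connectedness of the graph induced on
  \<open>D\<close> is the inclusion \<open>D \<times> D \<subseteq> linked A m D\<close>.\<close>

definition linked :: "('a \<Rightarrow> 'a \<Rightarrow> real) \<Rightarrow> real \<Rightarrow> 'a set \<Rightarrow> ('a \<times> 'a) set" where
  "linked A m D = {(x, y). x \<in> D \<and> y \<in> D \<and> exceeds A m x y}\<^sup>*"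

lemma linked_path:
  assumes "(d, x) \<in> linked A m D" "d \<in> D" "x \<in> D"
  shows "\<exists>p. set (d # p) \<subseteq> D \<and> last (d # p) = x \<and> successively (exceeds A m) (d # p)"
  using assms(1,2) unfolding linked_def
proof (induction rule: converse_rtrancl_induct)
  case base
  then show ?case by (intro exI[of _ "[]"]) auto
next
  case (step y z)
  then obtain p where "set (z # p) \<subseteq> D" "last (z # p) = x" "successively (exceeds A m) (z # p)" by auto
  with step show ?case by (intro exI[of _ "z # p"]) auto
qed

text \<open>A shortest path of the graph \<open>exceeds A m\<close> is induced, hence chordless.\<close>

lemma shortest_path_chordless:
  assumes sym: "\<And>x y. x \<in> insert n D \<Longrightarrow> y \<in> insert n D \<Longrightarrow> A x y = A y x"
    and "n \<notin> D" "d \<in> D" "exceeds A m n d" "x \<in> D" "x \<in> X" "(d, x) \<in> linked A m D"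
  obtains p where "p \<noteq> []" "set p \<subseteq> D" "last p \<in> X" "set (butlast p) \<inter> X = {}"
    "exceeds A m n (hd p)" "chordless A (n # p)"
proof -
  \<comment> \<open>Competing paths may end anywhere in \<open>X\<close>, not only at
    \<open>x\<close>, so minimal length rules out early visits to \<open>X\<close> as well as
    chords.\<close>
  define P where
    "P p \<longleftrightarrow> p \<noteq> [] \<and> set p \<subseteq> D \<and> last p \<in> X \<and> successively (exceeds A m) (n # p)" for p
  obtain p0 where p0: "set (d # p0) \<subseteq> D" "last (d # p0) = x" "successively (exceeds A m) (d # p0)"
    using linked_path[OF assms(7,3,5)] by auto
  have "P (d # p0)"
    unfolding P_def using p0 assms by simp
  then obtain p where p: "P p" and min: "\<And>q. P q \<Longrightarrow> length p \<le> length q"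
    using ex_has_least_nat[of P "d # p0" length] by blast
  show ?thesis
  proof (rule that)
    show "p \<noteq> []" "set p \<subseteq> D" "last p \<in> X" using p by (auto simp: P_def)
    show "exceeds A m n (hd p)" using p by (cases p) (auto simp: P_def)
    show "set (butlast p) \<inter> X = {}"
    proof (rule ccontr)
      assume "set (butlast p) \<inter> X \<noteq> {}"
      then obtain x where x: "x \<in> set (butlast p)" "x \<in> X" by auto
      then obtain us vs where "butlast p = us @ x # vs" by (meson split_list)
      then have "p = us @ x # vs @ [last p]"
        using \<open>p \<noteq> []\<close> by (metis append.assoc append_Cons append_butlast_last_id)
      then obtain l where eq: "p = us @ x # vs @ [l]" by blast
      have "P (us @ [x])"
        using p x unfolding P_def eq
        by (cases us) (auto simp: successively_append_iff successively_Cons hd_append split: if_splits)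
      from min[OF this] show False unfolding eq by simp
    qed
    show "chordless A (n # p)"
    proof (rule chordlessI)
      fix xs x y z ys assume eq: "n # p = xs @ x # y # z # ys"
      have s: "successively (exceeds A m) (xs @ x # y # z # ys)"
        using p eq by (simp add: P_def)
      then have adj: "exceeds A m x y" "exceeds A m y z"
        by (auto simp: successively_append_iff)
      have inD: "set (xs @ x # y # z # ys) \<subseteq> insert n D"
        using p unfolding eq[symmetric] by (auto simp: P_def)
      have tlD: "y \<in> D" "z \<in> D" "set ys \<subseteq> D" using eq p by (cases xs; auto simp: P_def)+
      \<comment> \<open>If \<open>x = z\<close>, then \<open>x\<close> lies in \<open>D\<close> and
        is not \<open>n\<close>; dropping \<open>x\<close> and \<open>y\<close> leaves a shorter
        competitor.\<close>
      have "x \<noteq> z"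
      proof
        assume xz: "x = z"
        then obtain xs' where xs: "xs = n # xs'" using eq tlD assms(2) by (cases xs) auto
        have pe: "p = xs' @ x # y # z # ys" using eq xs by simp
        have "P (xs' @ z # ys)"
          using p unfolding P_def pe xz
          by (auto simp: successively_append_iff successively_Cons hd_append split: if_splits)
        then show False using min[of "xs' @ z # ys"] pe by simp
      qed
      \<comment> \<open>An edge from \<open>x\<close> to \<open>z\<close> would bypass
        \<open>y\<close>. Hence \<open>A x z \<le> m\<close>, strictly below both path entries. If
        \<open>xs = []\<close>, the bypass starts at \<open>n\<close> itself.\<close>
      moreover have "\<not> exceeds A m x z"
      proof
        assume xz: "exceeds A m x z"
        show False
        proof (cases xs)
          case Nil
          then have pe: "p = y # z # ys" "x = n" using eq by auto
          have "P (z # ys)"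
            using p xz unfolding P_def pe by (auto simp: successively_Cons)
          then show False using min[of "z # ys"] pe by simp
        next
          case (Cons n' xs')
          then have pe: "p = xs' @ x # y # z # ys" "n' = n" using eq by auto
          have "P (xs' @ x # z # ys)"
            using p xz unfolding P_def pe
            by (auto simp: successively_append_iff successively_Cons hd_append split: if_splits)
          then show False using min[of "xs' @ x # z # ys"] pe by simp
        qed
      qed
      moreover have "A z y = A y z" using sym tlD by blast
      ultimately show "chordless_triple A x y z"
        using adj unfolding chordless_triple_def exceeds_def by linarith
    qed
  qed
qed

section \<open>Separators with two full components\<close>

text \<open>Two full components \<open>C\<close>, \<open>D\<close> of the graph \<open>exceeds A m\<close> minus the separator \<open>N\<close>.\<close>

definition full_separation ::
  "'a set \<Rightarrow> ('a \<Rightarrow> 'a \<Rightarrow> real) \<Rightarrow> real \<Rightarrow> 'a set \<Rightarrow> 'a set \<Rightarrow> 'a set \<Rightarrow> bool" where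
  "full_separation U A m C N D \<longleftrightarrow>
     C \<subseteq> U \<and> N \<subseteq> U \<and> D \<subseteq> U \<and> C \<inter> N = {} \<and> D \<inter> N = {} \<and> C \<inter> D = {} \<and> D \<noteq> {} \<and> C \<noteq> {} \<and>
     (\<forall>x \<in> C. \<forall>y \<in> U. exceeds A m x y \<longrightarrow> y \<in> C \<union> N) \<and>
     (\<forall>x \<in> D. \<forall>y \<in> U. exceeds A m x y \<longrightarrow> y \<in> D \<union> N) \<and>
     (\<forall>n \<in> N. (\<exists>c \<in> C. exceeds A m n c) \<and> (\<exists>d \<in> D. exceeds A m n d)) \<and>
     C \<times> C \<subseteq> linked A m C \<and> D \<times> D \<subseteq> linked A m D"

lemma full_separation_swap: "full_separation U A m C N D \<Longrightarrow> full_separation U A m D N C"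
  unfolding full_separation_def by (elim conjE, intro conjI) (simp_all add: Int_commute conj_commute)

text \<open>Collects what is needed to prolong walks from \<open>C\<close> into \<open>D\<close>;
  the opposite direction comes from \<open>full_separation_swap\<close>.\<close>

lemma full_separationD:
  assumes "full_separation U A m C N D"
  shows "C \<subseteq> U" "N \<subseteq> U" "D \<subseteq> U" "C \<inter> N = {}" "D \<inter> N = {}" "C \<inter> D = {}" "D \<noteq> {}"
    and "\<And>x y. x \<in> C \<Longrightarrow> y \<in> U \<Longrightarrow> exceeds A m x y \<Longrightarrow> y \<in> C \<union> N"
    and "\<And>n. n \<in> N \<Longrightarrow> \<exists>d \<in> D. exceeds A m n d"
    and "\<And>x y. x \<in> D \<Longrightarrow> y \<in> D \<Longrightarrow> (x, y) \<in> linked A m D"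
  using assms unfolding full_separation_def by (elim conjE, simp add: subset_eq)+

lemma component_linked:
  fixes m :: real
  assumes sym: "\<And>x y. x \<in> U \<Longrightarrow> y \<in> U \<Longrightarrow> A x y = A y x" and "a \<in> U"
  defines "C \<equiv> linked A m U `` {a}"
  shows "C \<subseteq> U" "a \<in> C" "C \<times> C \<subseteq> linked A m C"
    and "\<And>x y. x \<in> C \<Longrightarrow> y \<in> U \<Longrightarrow> exceeds A m x y \<Longrightarrow> y \<in> C"
proof -
  have "x \<in> U" if "(a, x) \<in> linked A m U" for x
    using that \<open>a \<in> U\<close> unfolding linked_def by (induction rule: rtrancl_induct) auto
  then show CU: "C \<subseteq> U" by (auto simp: C_def)
  show aC: "a \<in> C" by (simp add: C_def linked_def)
  show closed: "y \<in> C" if "x \<in> C" "y \<in> U" "exceeds A m x y" for x y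
    using that CU unfolding C_def linked_def by (auto intro: rtrancl_into_rtrancl)
  \<comment> \<open>Links must run inside \<open>C\<close>: every vertex on a path from
    \<open>a\<close> is itself reachable from \<open>a\<close>, so the path never leaves
    \<open>C\<close>.\<close>
  have from_a: "(a, x) \<in> linked A m C" if "(a, x) \<in> linked A m U" for x
    using that unfolding linked_def
  proof (induction rule: rtrancl_induct)
    case (step y z)
    then have "y \<in> C" by (simp add: C_def linked_def)
    with step closed show ?case by (auto intro: rtrancl_into_rtrancl)
  qed simp
  have "sym {(x, y). x \<in> C \<and> y \<in> C \<and> exceeds A m x y}"
    using CU sym by (auto simp: sym_def exceeds_def subset_eq)
  then have sl: "sym (linked A m C)" by (simp add: linked_def sym_rtrancl)
  have tl: "trans (linked A m C)" by (simp add: linked_def trans_rtrancl)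
  show "C \<times> C \<subseteq> linked A m C"
    using from_a sl tl unfolding C_def by (auto dest: symD transD)
qed

text \<open>Delete \<open>b\<close> and its neighbours; \<open>a\<close> survives because
  \<open>A a b = m\<close>. Let \<open>C\<close> be the component of \<open>a\<close>,
  \<open>N\<close> its boundary, and \<open>D\<close> the component of \<open>b\<close> outside
  \<open>C \<union> N\<close>. A boundary vertex not adjacent to \<open>b\<close> would have been
  absorbed into \<open>C\<close>, so every vertex of \<open>N\<close> has neighbours on both
  sides.\<close>

lemma full_separation_exists:
  fixes A :: "'a \<Rightarrow> 'a \<Rightarrow> real"
  assumes sym: "\<And>x y. x \<in> U \<Longrightarrow> y \<in> U \<Longrightarrow> A x y = A y x"
    and "a \<in> U" "b \<in> U" "a \<noteq> b" "A a b = m"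
  obtains C N D where "full_separation U A m C N D" "a \<in> C" "b \<in> D"
proof -
  define U1 where "U1 = {x \<in> U. x \<noteq> b \<and> \<not> exceeds A m b x}"
  define C where "C = linked A m U1 `` {a}"
  define N where "N = {n \<in> U - C. \<exists>c \<in> C. exceeds A m c n}"
  define U2 where "U2 = U - (C \<union> N)"
  define D where "D = linked A m U2 `` {b}"
  have adj_sym: "exceeds A m x y \<longleftrightarrow> exceeds A m y x" if "x \<in> U" "y \<in> U" for x y
    using sym[OF that] by (auto simp: exceeds_def)
  have "a \<in> U1" using assms by (auto simp: U1_def exceeds_def)
  moreover have "A x y = A y x" if "x \<in> U1" "y \<in> U1" for x y using that sym by (simp add: U1_def)
  ultimately have C: "C \<subseteq> U1" "a \<in> C" "C \<times> C \<subseteq> linked A m C"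
    "\<And>x y. x \<in> C \<Longrightarrow> y \<in> U1 \<Longrightarrow> exceeds A m x y \<Longrightarrow> y \<in> C"
    using component_linked[where U = U1 and A = A and a = a and m = m] unfolding C_def by blast+
  have nb: "exceeds A m n b" if "n \<in> N" for n
  proof -
    from that obtain c where c: "n \<in> U" "n \<notin> C" "c \<in> C" "exceeds A m c n" by (auto simp: N_def)
    have "c \<in> U1" using c C by auto
    then have "n \<noteq> b" using c adj_sym[of c b] \<open>b \<in> U\<close> by (auto simp: U1_def)
    then show ?thesis using c C(4)[of c n] adj_sym[of n b] \<open>b \<in> U\<close> by (auto simp: U1_def)
  qed
  have "b \<in> U2" using nb \<open>b \<in> U\<close> C(1) by (auto simp: U2_def U1_def exceeds_def)
  moreover have "A x y = A y x" if "x \<in> U2" "y \<in> U2" for x y using that sym by (simp add: U2_def)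
  ultimately have D: "D \<subseteq> U2" "b \<in> D" "D \<times> D \<subseteq> linked A m D"
    "\<And>x y. x \<in> D \<Longrightarrow> y \<in> U2 \<Longrightarrow> exceeds A m x y \<Longrightarrow> y \<in> D"
    using component_linked[where U = U2 and A = A and a = b and m = m] unfolding D_def by blast+
  have CU: "C \<subseteq> U" using C(1) by (auto simp: U1_def)
  have Dnb: "y \<in> D \<union> N" if xy: "x \<in> D" "y \<in> U" "exceeds A m x y" for x y
  proof (cases "y \<in> C")
    case True
    have "x \<in> U - (C \<union> N)" using xy D(1) by (auto simp: U2_def)
    then have False using True adj_sym[of x y] xy by (auto simp: N_def)
    then show ?thesis ..
  next
    case False
    then show ?thesis using xy D(4) by (auto simp: U2_def)
  qed
  have Nc: "\<exists>c \<in> C. exceeds A m n c" if "n \<in> N" for n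
    using that adj_sym CU by (auto simp: N_def subset_eq)
  have Cnb: "y \<in> C \<union> N" if "x \<in> C" "y \<in> U" "exceeds A m x y" for x y
    using that by (auto simp: N_def)
  have "C \<inter> N = {}" "N \<subseteq> U" "D \<subseteq> U - (C \<union> N)"
    using D(1) by (auto simp: N_def U2_def)
  then have "N \<subseteq> U" "D \<subseteq> U" "C \<inter> N = {}" "D \<inter> N = {}" "C \<inter> D = {}" by auto
  moreover have "\<forall>n \<in> N. (\<exists>c \<in> C. exceeds A m n c) \<and> (\<exists>d \<in> D. exceeds A m n d)"
    using Nc nb D(2) by blast
  moreover have "D \<noteq> {}" "C \<noteq> {}" using C(2) D(2) by auto
  ultimately have "full_separation U A m C N D"
    unfolding full_separation_def using CU C(3) D(3) Cnb Dnb by (intro conjI ballI impI) simp_all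
  from that[OF this C(2) D(2)] show ?thesis .
qed

section \<open>Prolonging chordless walks\<close>

text \<open>At the junction \<open>c\<close>, \<open>n\<close>, \<open>hd p\<close> the outer entry
  joins \<open>C\<close> to \<open>D\<close> and does not exceed \<open>m\<close>, while the inner
  ones do. All other triples lie in the old walk or in a shortest path from
  \<open>n\<close>.\<close>

lemma chordless_extend_path:
  assumes sep: "full_separation U A m C N D"
    and sym: "\<And>x y. x \<in> U \<Longrightarrow> y \<in> U \<Longrightarrow> A x y = A y x"
    and "c \<in> C" "n \<in> N" "exceeds A m c n" "chordless A (xs @ [c, n])" "D \<inter> X \<noteq> {}"
  obtains q y where "chordless A (xs @ c # n # q @ [y])" "y \<in> D \<inter> X" "set q \<subseteq> D - X"
proof -
  obtain d x where d: "d \<in> D" "exceeds A m n d" and x: "x \<in> D" "x \<in> X" "(d, x) \<in> linked A m D"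
    using full_separationD(9)[OF sep \<open>n \<in> N\<close>] full_separationD(10)[OF sep] \<open>D \<inter> X \<noteq> {}\<close> by blast
  have U: "insert n D \<subseteq> U" "c \<in> U" "n \<notin> D" "c \<notin> D"
    using full_separationD(1-6)[OF sep] assms(3,4) by auto
  obtain p where p: "p \<noteq> []" "set p \<subseteq> D" "last p \<in> X" "set (butlast p) \<inter> X = {}"
    "exceeds A m n (hd p)" "chordless A (n # p)"
    using shortest_path_chordless[of n D A d m x X] sym U d x by blast
  have h: "hd p \<in> D" using p by auto
  have "\<not> exceeds A m c (hd p)"
    using full_separationD(3,5,6)[OF sep] full_separationD(8)[OF sep \<open>c \<in> C\<close>] h by blast
  then have "chordless_triple A c n (hd p)"
    using h U \<open>exceeds A m c n\<close> p(5) sym[of n "hd p"]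
    by (auto simp: chordless_triple_def exceeds_def)
  then have "chordless A (c # n # p)" using p by (cases p) auto
  from chordless_glue[OF assms(6) this]
  have "chordless A (xs @ c # n # butlast p @ [last p])" using p by simp
  then show ?thesis
    by (rule that) (use p in \<open>auto dest: in_set_butlastD\<close>)
qed

text \<open>Prolong the last end, reverse, and prolong the other end. The arbitrary prefix
  \<open>xs\<close> in \<open>ext\<close> lets the first prolongation be carried along.\<close>

lemma extend_both_ends:
  assumes sym: "\<And>x y. x \<in> U \<Longrightarrow> y \<in> U \<Longrightarrow> A x y = A y x"
    and W: "chordless A (s # cs @ [s'])" "cs \<noteq> []" "set cs \<subseteq> C" "s \<in> E" "s' \<in> E" "C \<subseteq> U" "E \<subseteq> U"
    and ext: "\<And>xs c e. c \<in> set cs \<Longrightarrow> e \<in> {s, s'} \<Longrightarrow> exceeds A m c e \<Longrightarrow> chordless A (xs @ [c, e]) \<Longrightarrow>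
      \<exists>q y. chordless A (xs @ c # q @ [y]) \<and> y \<in> Y \<and> set q \<subseteq> Z"
    and ends: "exceeds A m (hd cs) s" "exceeds A m (last cs) s'"
    and YZ: "Y \<subseteq> U" "Z \<subseteq> U"
  shows "\<exists>q y y'. chordless A (y # q @ [y']) \<and> y \<in> Y \<and> y' \<in> Y \<and> set q \<subseteq> Z \<union> set cs \<and> set cs \<subseteq> set q"
proof -
  have "chordless A ((s # butlast cs) @ [last cs, s'])"
    using W(1,2) by (metis append.assoc append_Cons append_Nil append_butlast_last_id)
  from ext[OF _ _ _ this] obtain q y
    where q: "chordless A ((s # butlast cs) @ last cs # q @ [y])" "y \<in> Y" "set q \<subseteq> Z"
    using W(2) ends(2) by auto
  have eq: "(s # butlast cs) @ last cs # q @ [y] = s # hd cs # tl cs @ q @ [y]"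
    using W(2) by (metis append.assoc append_Cons append_Nil append_butlast_last_id list.collapse)
  have "set (s # hd cs # tl cs @ q @ [y]) \<subseteq> U"
    using W q YZ by (cases cs) auto
  then have "chordless A (rev (s # hd cs # tl cs @ q @ [y]))"
    using q(1) sym unfolding eq by (intro chordless_rev) (auto simp: subset_eq)
  then have "chordless A ((y # rev q @ rev (tl cs)) @ [hd cs, s])" by simp
  from ext[OF _ _ _ this] obtain q' y'
    where q': "chordless A ((y # rev q @ rev (tl cs)) @ hd cs # q' @ [y'])" "y' \<in> Y" "set q' \<subseteq> Z"
    using W(2) ends(1) by auto
  have "set cs = insert (hd cs) (set (tl cs))" using W(2) by (cases cs) auto
  then show ?thesis
    using q q' by (intro exI[of _ "rev q @ rev (tl cs) @ hd cs # q'"] exI[of _ y] exI[of _ y']) auto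
qed

text \<open>The outer entry of the first triple is at least \<open>m\<close>, since its vertices are
  distinct, and the inner entries are strictly larger. Symmetry of \<open>A\<close> keeps the middle
  vertex distinct from the outer ones.\<close>

lemma ends_exceed:
  assumes low: "\<And>x y. x \<in> U \<Longrightarrow> y \<in> U \<Longrightarrow> x \<noteq> y \<Longrightarrow> m \<le> A x y"
    and sym: "\<And>x y. x \<in> U \<Longrightarrow> y \<in> U \<Longrightarrow> A x y = A y x"
    and W: "chordless A (s # cs @ [s'])" "cs \<noteq> []" "set (s # cs @ [s']) \<subseteq> U"
  shows "exceeds A m (hd cs) s" "exceeds A m (last cs) s'"
proof -
  have *: "exceeds A m y x" if "chordless_triple A x y z" "x \<in> U" "y \<in> U" "z \<in> U" for x y z
    using that low[of x z] sym[of x y] sym[of x z] by (auto simp: chordless_triple_def exceeds_def)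
  \<comment> \<open>Restated for arbitrary walks, to be applied to the reversed one as well.\<close>
  have *: "exceeds A m (hd cs) s"
    if "chordless A (s # cs @ [s'])" "cs \<noteq> []" "set (s # cs @ [s']) \<subseteq> U" for s cs s'
  proof (cases cs)
    case (Cons c ds)
    then show ?thesis using that *[of s c "hd (ds @ [s'])"] by (cases ds) auto
  qed (use that in auto)
  show "exceeds A m (hd cs) s" using *[OF W] .
  have "chordless A (rev (s # cs @ [s']))"
    using W sym by (intro chordless_rev) (auto simp: subset_eq)
  then have "chordless A (s' # rev cs @ [s])" by simp
  from *[OF this] show "exceeds A m (last cs) s'" using W by (auto simp: hd_rev)
qed

section \<open>Uses of a separation: pairs, simplicial vertices, walks\<close>

definition self_contained_pair :: "'a set \<Rightarrow> ('a \<Rightarrow> 'a \<Rightarrow> real) \<Rightarrow> bool" where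
  "self_contained_pair V A \<longleftrightarrow>
     (\<exists>W1 W2. is_walk V W1 \<and> is_walk V W2 \<and> weighted_chordless A W1 \<and>
              weighted_chordless A W2 \<and> self_contained W1 W2)"

text \<open>Each closed walk has a single end vertex, and it is internal to the other walk.\<close>

lemma self_contained_pairI:
  assumes "chordless A (d # q @ [d])" "chordless A (c # r @ [c])" "c \<in> set q" "d \<in> set r"
    and "set q \<subseteq> V" "set r \<subseteq> V"
  shows "self_contained_pair V A"
  unfolding self_contained_pair_def
  by (rule exI[of _ "d # q @ [d]"], rule exI[of _ "c # r @ [c]"])
    (use assms in \<open>auto simp: is_walk_def self_contained_def internal_Cons_snoc
      chordless_imp_weighted_chordless\<close>)

text \<open>Neighbours of \<open>v\<close> lie in \<open>C \<union> N\<close>, so a pair involving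
  any other vertex has minimum at most \<open>m\<close>, which bounds every off-diagonal entry from
  below.\<close>

lemma simplicial_component:
  assumes sep: "full_separation U A m C N D"
    and low: "\<And>x y. x \<in> U \<Longrightarrow> y \<in> U \<Longrightarrow> x \<noteq> y \<Longrightarrow> m \<le> A x y"
    and "simplicial (C \<union> N) A v" "v \<in> C"
  shows "simplicial U A v"
  unfolding simplicial_def
proof (intro conjI ballI impI)
  show "v \<in> U" using full_separationD(1)[OF sep] \<open>v \<in> C\<close> by blast
  fix y z assume yz: "y \<in> U - {v}" "z \<in> U - {v}" "y \<noteq> z"
  have *: "A v x \<le> m" if "x \<in> U - {v}" "x \<notin> C \<union> N" for x
    using that full_separationD(8)[OF sep \<open>v \<in> C\<close>, of x] by (force simp: exceeds_def)
  show "min (A v y) (A v z) \<le> A y z"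
  proof (cases "y \<in> C \<union> N \<and> z \<in> C \<union> N")
    case True
    then show ?thesis using assms(3) yz unfolding simplicial_def by auto
  next
    case False
    then show ?thesis using *[of y] *[of z] low[of y z] yz by (auto simp: min_def)
  qed
qed

text \<open>Ends in \<open>N - S\<close> are prolonged into \<open>D\<close> up to the first vertex
  of \<open>S\<close>, which keeps the new interior outside \<open>S\<close>.\<close>

lemma walk_prolonged_into:
  assumes sep: "full_separation U A m C N D"
    and low: "\<And>x y. x \<in> U \<Longrightarrow> y \<in> U \<Longrightarrow> x \<noteq> y \<Longrightarrow> m \<le> A x y"
    and sym: "\<And>x y. x \<in> U \<Longrightarrow> y \<in> U \<Longrightarrow> A x y = A y x"
    and W: "chordless A (s # cs @ [s'])" "cs \<noteq> []" "set cs \<subseteq> C - S"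
      "s \<in> (S \<inter> C) \<union> N" "s' \<in> (S \<inter> C) \<union> N"
    and "D \<inter> S \<noteq> {}" "S \<subseteq> U"
  shows "\<exists>s cs s'. s \<in> S \<and> s' \<in> S \<and> cs \<noteq> [] \<and> set cs \<subseteq> U - S \<and> chordless A (s # cs @ [s'])"
proof -
  have CND: "C \<subseteq> U" "N \<subseteq> U" "D \<subseteq> U" using full_separationD(1-3)[OF sep] by auto
  have "\<exists>q y y'. chordless A (y # q @ [y']) \<and> y \<in> S \<and> y' \<in> S \<and> set q \<subseteq> (U - S) \<union> set cs \<and>
      set cs \<subseteq> set q"
  proof (rule extend_both_ends[where C = C and E = "(S \<inter> C) \<union> N" and U = U])
    have "set (s # cs @ [s']) \<subseteq> U" using W CND by auto
    from ends_exceed[OF low sym W(1,2) this]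
    show "exceeds A m (hd cs) s" "exceeds A m (last cs) s'" by blast+
    fix xs c e
    assume h: "c \<in> set cs" "e \<in> {s, s'}" "exceeds A m c e" "chordless A (xs @ [c, e])"
    show "\<exists>q y. chordless A (xs @ c # q @ [y]) \<and> y \<in> S \<and> set q \<subseteq> U - S"
    proof (cases "e \<in> S")
      case True
      \<comment> \<open>An end already in \<open>S\<close> stays as it is: nothing is
        inserted.\<close>
      then show ?thesis using h by (intro exI[of _ "[]"] exI[of _ e]) auto
    next
      case False
      then have "e \<in> N" "c \<in> C" using h W by auto
      from chordless_extend_path[OF sep sym this(2,1) h(3,4) \<open>D \<inter> S \<noteq> {}\<close>]
      obtain q y where "chordless A (xs @ c # e # q @ [y])" "y \<in> D \<inter> S" "set q \<subseteq> D - S" by blast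
      then show ?thesis using False \<open>e \<in> N\<close> CND
        by (intro exI[of _ "e # q"] exI[of _ y]) auto
    qed
  qed (use sym W CND \<open>S \<subseteq> U\<close> in auto)
  then obtain q y y' where q: "chordless A (y # q @ [y'])" "y \<in> S" "y' \<in> S"
    "set q \<subseteq> (U - S) \<union> set cs" "set cs \<subseteq> set q" by blast
  moreover have "q \<noteq> []" using q(5) W(2) by auto
  moreover have "set q \<subseteq> U - S" using q(4) W(3) CND by blast
  ultimately show ?thesis by blast
qed

text \<open>With the target set \<open>{d}\<close> both ends reach the same vertex, so the walk
  closes up and keeps \<open>cs\<close> in its interior.\<close>

lemma walk_prolonged_to_vertex:
  assumes sep: "full_separation U A m C N D"
    and low: "\<And>x y. x \<in> U \<Longrightarrow> y \<in> U \<Longrightarrow> x \<noteq> y \<Longrightarrow> m \<le> A x y"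
    and sym: "\<And>x y. x \<in> U \<Longrightarrow> y \<in> U \<Longrightarrow> A x y = A y x"
    and W: "chordless A (s # cs @ [s'])" "cs \<noteq> []" "set cs \<subseteq> C" "s \<in> N" "s' \<in> N"
    and "d \<in> D"
  obtains q where "chordless A (d # q @ [d])" "set cs \<subseteq> set q" "set q \<subseteq> U"
proof -
  have CND: "C \<subseteq> U" "N \<subseteq> U" "D \<subseteq> U" using full_separationD(1-3)[OF sep] by auto
  have "\<exists>q y y'. chordless A (y # q @ [y']) \<and> y \<in> {d} \<and> y' \<in> {d} \<and> set q \<subseteq> U \<union> set cs \<and>
      set cs \<subseteq> set q"
  proof (rule extend_both_ends[where C = C and E = N and U = U])
    have "set (s # cs @ [s']) \<subseteq> U" using W CND by auto
    from ends_exceed[OF low sym W(1,2) this]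
    show "exceeds A m (hd cs) s" "exceeds A m (last cs) s'" by blast+
    fix xs c e
    assume h: "c \<in> set cs" "e \<in> {s, s'}" "exceeds A m c e" "chordless A (xs @ [c, e])"
    have "e \<in> N" "c \<in> C" "D \<inter> {d} \<noteq> {}" using h W \<open>d \<in> D\<close> by auto
    from chordless_extend_path[OF sep sym this(2,1) h(3,4) this(3)]
    obtain q y where "chordless A (xs @ c # e # q @ [y])" "y \<in> D \<inter> {d}" "set q \<subseteq> D - {d}" by blast
    then show "\<exists>q y. chordless A (xs @ c # q @ [y]) \<and> y \<in> {d} \<and> set q \<subseteq> U"
      using \<open>e \<in> N\<close> CND by (intro exI[of _ "e # q"] exI[of _ y]) auto
  qed (use sym W CND \<open>d \<in> D\<close> in auto)
  then obtain q where q: "chordless A (d # q @ [d])" "set q \<subseteq> U \<union> set cs" "set cs \<subseteq> set q"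
    by blast
  show ?thesis by (rule that[OF q(1,3)]) (use q(2) W(3) CND in blast)
qed

section \<open>Induction on the ground set\<close>

text \<open>\<open>V\<close> stays fixed while \<open>U\<close> shrinks, so the absence of
  self-contained pairs passes to the smaller instances unchanged.\<close>

lemma simplicial_or_walk:
  assumes "finite U" "\<And>x y. x \<in> U \<Longrightarrow> y \<in> U \<Longrightarrow> A x y = A y x" "S \<subset> U"
    and "\<And>v. v \<in> U - S \<Longrightarrow> \<not> simplicial U A v" "\<not> self_contained_pair V A" "U \<subseteq> V"
  shows "\<exists>s cs s'. s \<in> S \<and> s' \<in> S \<and> cs \<noteq> [] \<and> set cs \<subseteq> U - S \<and> chordless A (s # cs @ [s'])"
  using assms
proof (induction "card U" arbitrary: U S rule: less_induct)
  case less
  note sym = less(3)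
  obtain c0 where c0: "c0 \<in> U - S" using less(4) by auto
  \<comment> \<open>A one-element \<open>U\<close> would make \<open>c0\<close> vacuously
    simplicial.\<close>
  then obtain b0 where "b0 \<in> U" "b0 \<noteq> c0"
    using less(5)[of c0] unfolding simplicial_def by auto
  with c0 obtain x0 y0 where xy: "x0 \<in> U" "y0 \<in> U" "x0 \<noteq> y0"
    and min: "\<And>u v. u \<in> U \<Longrightarrow> v \<in> U \<Longrightarrow> u \<noteq> v \<Longrightarrow> A x0 y0 \<le> A u v"
    using attains_minimum[OF less(2), of c0 b0 A] by blast
  define m where "m = A x0 y0"
  note low = min[folded m_def]
  show ?case
  proof (cases "\<exists>a \<in> U - S. \<exists>b \<in> U. a \<noteq> b \<and> A a b = m")
    case False
    then have S: "x0 \<in> S" "y0 \<in> S" using xy sym[of x0 y0] by (auto simp: m_def)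
    have ne: "A c0 x0 \<noteq> m" "A c0 y0 \<noteq> m" "c0 \<noteq> x0" "c0 \<noteq> y0" using False c0 xy S by auto
    then have "m < A c0 x0" "m < A c0 y0" using low[of c0 x0] low[of c0 y0] xy c0 by auto
    then have "chordless_triple A x0 c0 y0"
      using xy c0 sym[of c0 x0] sym[of c0 y0] by (auto simp: chordless_triple_def m_def)
    then show ?thesis using S c0
      by (intro exI[of _ x0] exI[of _ "[c0]"] exI[of _ y0]) auto
  next
    case True
    then obtain a b where ab: "a \<in> U - S" "b \<in> U" "a \<noteq> b" "A a b = m" by blast
    then obtain C N D where sep: "full_separation U A m C N D" "a \<in> C" "b \<in> D"
      using full_separation_exists[of U A a b m] sym by blast
    \<comment> \<open>All of \<open>N\<close> joins the exceptional set, because simpliciality in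
      \<open>C \<union> N\<close> transfers to \<open>U\<close> only at vertices of
      \<open>C\<close>. Stated for arbitrary \<open>C\<close> and \<open>D\<close>, to serve both
      sides of the separation.\<close>
    have IH: "\<exists>s cs s'. s \<in> (S \<inter> C) \<union> N \<and> s' \<in> (S \<inter> C) \<union> N \<and> cs \<noteq> [] \<and> set cs \<subseteq> C - S \<and>
        chordless A (s # cs @ [s'])"
      if sep: "full_separation U A m C N D" and "C - S \<noteq> {}" for C D
    proof -
      have CN: "C \<union> N \<subset> U" "C \<inter> N = {}" using full_separationD(1-7)[OF sep] by auto
      have eq: "C \<union> N - ((S \<inter> C) \<union> N) = C - S" using CN by auto
      have "\<exists>s cs s'. s \<in> (S \<inter> C) \<union> N \<and> s' \<in> (S \<inter> C) \<union> N \<and> cs \<noteq> [] \<and>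
          set cs \<subseteq> C \<union> N - ((S \<inter> C) \<union> N) \<and> chordless A (s # cs @ [s'])"
      proof (rule less(1))
        show "card (C \<union> N) < card U" using CN less(2) psubset_card_mono by blast
        show "finite (C \<union> N)" using CN less(2) by (meson finite_subset psubset_imp_subset)
        show "A x y = A y x" if "x \<in> C \<union> N" "y \<in> C \<union> N" for x y
          using that CN sym by blast
        show "(S \<inter> C) \<union> N \<subset> C \<union> N" using CN \<open>C - S \<noteq> {}\<close> by auto
        show "\<not> simplicial (C \<union> N) A v" if "v \<in> C \<union> N - ((S \<inter> C) \<union> N)" for v
          using that less(5)[of v] simplicial_component[OF sep low, of v] CN by blast
        show "C \<union> N \<subseteq> V" using CN less(7) by blast
      qed (rule less(6))
      then show ?thesis unfolding eq .
    qed
    \<comment> \<open>\<open>C - S\<close> is nonempty since it contains \<open>a\<close>.\<close>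
    obtain s cs s' where W: "chordless A (s # cs @ [s'])" "cs \<noteq> []" "set cs \<subseteq> C - S"
      "s \<in> (S \<inter> C) \<union> N" "s' \<in> (S \<inter> C) \<union> N"
      using IH[OF sep(1)] sep ab by blast
    show ?thesis
    proof (cases "D \<inter> S = {}")
      case False
      from walk_prolonged_into[OF sep(1) low sym W this] show ?thesis using less(4) by blast
    next
      case DS: True
      have sep': "full_separation U A m D N C" using sep(1) by (rule full_separation_swap)
      obtain t ds t' where W': "chordless A (t # ds @ [t'])" "ds \<noteq> []" "set ds \<subseteq> D - S"
        "t \<in> (S \<inter> D) \<union> N" "t' \<in> (S \<inter> D) \<union> N"
        using IH[OF sep'] sep DS by blast
      show ?thesis
      proof (cases "C \<inter> S = {}")
        case False
        from walk_prolonged_into[OF sep' low sym W' this] show ?thesis using less(4) by blast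
      next
        case CS: True
        \<comment> \<open>The targets of the prolongations: internal vertices of the two walks,
          still internal after prolongation.\<close>
        have c: "hd cs \<in> C" "hd cs \<in> set cs" using W by (auto simp: subset_eq)
        have d: "hd ds \<in> D" "hd ds \<in> set ds" using W' by (auto simp: subset_eq)
        have "set cs \<subseteq> C" "s \<in> N" "s' \<in> N" using W CS by auto
        from walk_prolonged_to_vertex[OF sep(1) low sym W(1,2) this d(1)]
        obtain q where q: "chordless A (hd ds # q @ [hd ds])" "set cs \<subseteq> set q" "set q \<subseteq> U"
          by blast
        have "set ds \<subseteq> D" "t \<in> N" "t' \<in> N" using W' DS by auto
        from walk_prolonged_to_vertex[OF sep' low sym W'(1,2) this c(1)]
        obtain r where r: "chordless A (hd cs # r @ [hd cs])" "set ds \<subseteq> set r" "set r \<subseteq> U"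
          by blast
        have "self_contained_pair V A"
          by (rule self_contained_pairI[OF q(1) r(1)]) (use q(2,3) r(2,3) c(2) d(2) less(7) in auto)
        then show ?thesis using less(6) by blast
      qed
    qed
  qed
qed

section \<open>A second simplicial vertex or a critical walk\<close>

theorem theorem4:
  fixes V :: "'a set" and A :: "'a \<Rightarrow> 'a \<Rightarrow> real"
  assumes "finite V" and "card V \<ge> 2"
    and "\<forall>x \<in> V. \<forall>y \<in> V. A x y = A y x"
    and "\<not> (\<exists>W1 W2. is_walk V W1 \<and> is_walk V W2 \<and> weighted_chordless A W1 \<and>
              weighted_chordless A W2 \<and> self_contained W1 W2)"
  shows "(\<exists>W. critical_walk V A W) \<or>
         (\<exists>u v. u \<noteq> v \<and> simplicial V A u \<and> simplicial V A v \<and> A u v = minA V A)"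
proof -
  have sym: "A x y = A y x" if "x \<in> V" "y \<in> V" for x y using that assms(3) by blast
  have nsc: "\<not> self_contained_pair V A" using assms(4) by (simp add: self_contained_pair_def)
  obtain a b where "a \<in> V" "b \<in> V" "a \<noteq> b"
    using assms(1,2) by (metis card_le_Suc0_iff_eq not_less_eq_eq numeral_2_eq_2)
  then obtain x0 y0 where xy: "x0 \<in> V" "y0 \<in> V" "x0 \<noteq> y0"
    and min: "\<And>u v. u \<in> V \<Longrightarrow> v \<in> V \<Longrightarrow> u \<noteq> v \<Longrightarrow> A x0 y0 \<le> A u v"
    using attains_minimum[OF assms(1), of a b A] by blast
  define m where "m = A x0 y0"
  note low = min[folded m_def]
  have m: "minA V A = m" unfolding m_def by (rule minA_eqI) (use assms(1) xy min in blast)+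
  have "\<exists>w \<in> V. simplicial V A w"
    using simplicial_or_walk[of V A "{}" V] assms(1) sym nsc xy by blast
  then obtain w where w: "w \<in> V" "simplicial V A w" by blast
  define S where "S = {x \<in> V. x = w \<or> m < A w x}"
  \<comment> \<open>Otherwise all entries at \<open>w\<close> exceed \<open>m\<close>; then
    \<open>w\<close> is neither \<open>x0\<close> nor \<open>y0\<close>, and simpliciality at this
    pair forces \<open>A x0 y0 > m\<close>.\<close>
  have "S \<noteq> V"
  proof
    assume "S = V"
    then have above_m: "m < A w x" if "x \<in> V" "x \<noteq> w" for x using that by (auto simp: S_def)
    have "x0 \<noteq> w" "y0 \<noteq> w" using above_m[of x0] above_m[of y0] xy sym[of x0 y0] by (auto simp: m_def)
    then have "min (A w x0) (A w y0) \<le> m"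
      using w xy unfolding simplicial_def m_def by auto
    then show False using above_m[of x0] above_m[of y0] \<open>x0 \<noteq> w\<close> \<open>y0 \<noteq> w\<close> xy
      by (auto simp: min_def split: if_splits)
  qed
  then have S: "S \<subset> V" by (auto simp: S_def)
  have outside: "A w x = m" "x \<noteq> w" "x \<in> V" if "x \<in> V - S" for x
    using that low[of w x] w by (auto simp: S_def)
  show ?thesis
  proof (cases "\<exists>u \<in> V - S. simplicial V A u")
    case True
    then show ?thesis using outside w m by metis
  next
    case False
    then obtain s cs s' where W: "s \<in> S" "s' \<in> S" "cs \<noteq> []" "set cs \<subseteq> V - S"
      "chordless A (s # cs @ [s'])"
      using simplicial_or_walk[of V A S V] assms(1) sym nsc S by blast
    have inV: "set (s # cs @ [s']) \<subseteq> V" using W S by auto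
    have ends: "exceeds A m (hd cs) s" "exceeds A m (last cs) s'"
      by (rule ends_exceed[OF low sym W(5,3) inV]; assumption)+
    \<comment> \<open>The end \<open>e\<close> is not \<open>w\<close>, because
      \<open>A w c = m\<close> while \<open>c\<close> and \<open>e\<close> are adjacent. Hence
      \<open>m < A w e\<close>, and \<open>w\<close> can be attached before or after
      \<open>e\<close>.\<close>
    have *: "chordless_triple A w e c" "chordless_triple A c e w"
      if "exceeds A m c e" "c \<in> set cs" "e \<in> S" for c e
    proof -
      have c: "A w c = m" "c \<noteq> w" "c \<in> V" using outside[of c] that W(4) by auto
      have "e \<noteq> w" using that c sym[of w c] w by (auto simp: exceeds_def)
      then have "m < A w e" "e \<in> V" using that by (auto simp: S_def)
      then show "chordless_triple A w e c" "chordless_triple A c e w"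
        using that c sym[of w c] w by (auto simp: chordless_triple_def exceeds_def)
    qed
    define W' where "W' = w # (s # cs @ [s']) @ [w]"
    have "chordless A (s # cs @ [s', w])"
    proof (cases cs rule: rev_cases)
      case (snoc ds d)
      have "chordless A ((s # ds) @ [d, s'])" using W(5) snoc by simp
      moreover have "chordless A [d, s', w]" using *(2)[OF ends(2) _ W(2)] snoc by simp
      ultimately show ?thesis using chordless_glue[of A "s # ds" d s' "[w]"] snoc by simp
    qed (use W(3) in simp)
    then have "chordless A W'"
      using *(1)[OF ends(1) _ W(1)] W(3) unfolding W'_def by (cases cs) auto
    then have "weighted_chordless A W'" by (rule chordless_imp_weighted_chordless)
    \<comment> \<open>Any vertex of \<open>cs\<close> would do as the internal witness: all lie
      outside \<open>S\<close>.\<close>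
    moreover have "hd cs \<in> internal W'"
      using W(3) unfolding W'_def internal_Cons_snoc by simp
    moreover have "A w (hd cs) = m" using outside W(3,4) by (auto simp: subset_eq)
    moreover have "is_walk V W'" using inV w by (auto simp: is_walk_def W'_def)
    moreover have "hd W' = w" "last W' = w" by (simp_all add: W'_def)
    ultimately have "critical_walk V A W'"
      unfolding critical_walk_def closed_walk_def m using w(2) by metis
    then show ?thesis by blast
  qed
qed

end
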